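(* Let $d\ge1$, $\lambda\in\mathbb{R}\setminus\{0\}$ and $t>0$, and let $\Phi_B^t[w_0](x)=\mathrm{e}^{-\mathrm{i}\lambda t\ln|w_0(x)|^2}w_0(x)$ (equal to $0$ where $w_0(x)=0$). The following hold. (i) For any $w_0:\mathbb{T}^d\to\mathbb{C}$ and any $x,y\in\mathbb{T}^d$, $$\big|\Phi_B^t[w_0](x)-\Phi_B^t[w_0](y)\big|\le(1+2|\lambda|t)\,|w_0(x)-w_0(y)|,$$ which implies that if $w_0$ is Lipschitz continuous, so is $\Phi_B^t[w_0]$. (ii) For any $w_0\in H^s(\mathbb{T}^d)$ with $0<s<1$, $$\big|\Phi_B^t[w_0]\big|_{H^s(\mathbb{T}^d)}\le\mathcal{C}_1^{-1}\mathcal{C}_2\,(1+2|\lambda|t)\,|w_0|_{H^s(\mathbb{T}^d)},$$ where $\mathcal{C}_1,\mathcal{C}_2>0$ are the constants in the equivalence of semi-norms recalled in the context. (iii) For any $u,v\in L^2(\mathbb{T}^d)$, $$\big\|\Phi_B^t[u]-\Phi_B^t[v]\big\|\le(1+2|\lambda|t)\,\|u-v\|.$$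
   Context: $\mathbb{T}^d=[-\pi,\pi)^d$ is the torus, $|\mathbb{T}|=2\pi$; functions are complex-valued and extended $2\pi$-periodically. $\|\cdot\|$ is the $L^2(\mathbb{T}^d)$-norm. With $\hat u_k=|\mathbb{T}|^{-d}\int_{\mathbb{T}^d}u(x)\mathrm{e}^{-\mathrm{i}k\cdot x}\,\mathrm{d}x$, $|u|_{H^s(\mathbb{T}^d)}=|\mathbb{T}|^{d/2}\big(\sum_{k\in\mathbb{Z}^d\setminus\{0\}}|k|^{2s}|\hat u_k|^2\big)^{1/2}$, and $H^s(\mathbb{T}^d)$ is the space of $u\in L^2(\mathbb{T}^d)$ with $\sum_{k\in\mathbb{Z}^d}(1+|k|^2)^s|\hat u_k|^2<\infty$. Known equivalence (Bényi–Oh): for $0<s<1$ there are positive constants $\mathcal{C}_1,\mathcal{C}_2$, independent of $u$, such that for all $u\in H^s(\mathbb{T}^d)$ $$\mathcal{C}_1|u|_{H^s(\mathbb{T}^d)}\le\Big(\int_{\mathbb{T}^d}\int_{\mathbb{T}^d}\frac{|u(x+y)-u(y)|^2}{|x|^{d+2s}}\,\mathrm{d}x\,\mathrm{d}y\Big)^{1/2}\le\mathcal{C}_2|u|_{H^s(\mathbb{T}^d)}.$$ *)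

theory Defs
  imports "HOL-Analysis.Analysis"
begin

text \<open>
  The dimension is \<^term>\<open>CARD('n)\<close>. A function on the torus is represented by its periodic
  extension to \<^typ>\<open>real ^ 'n\<close>; integrals are taken over the fundamental cell.
\<close>

definition torus :: "(real ^ 'n::finite) set" where
  "torus = {x. \<forall>i. - pi \<le> x $ i \<and> x $ i < pi}"

definition vec_of_int :: "int ^ 'n \<Rightarrow> real ^ 'n::finite" where
  "vec_of_int k = (\<chi> i. of_int (k $ i))"

definition torus_periodic :: "(real ^ 'n::finite \<Rightarrow> complex) \<Rightarrow> bool" where
  "torus_periodic u \<longleftrightarrow> (\<forall>x k. u (x + (2 * pi) *\<^sub>R vec_of_int k) = u x)"

definition torus_L2 :: "(real ^ 'n::finite \<Rightarrow> complex) set" where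
  "torus_L2 = {u. torus_periodic u \<and> u \<in> borel_measurable lebesgue \<and>
     set_integrable lebesgue torus (\<lambda>x. (cmod (u x))\<^sup>2)}"

definition L2_norm_torus :: "(real ^ 'n::finite \<Rightarrow> complex) \<Rightarrow> real" where
  "L2_norm_torus u = sqrt (LINT x:torus|lebesgue. (cmod (u x))\<^sup>2)"

definition fourier_coeff :: "(real ^ 'n::finite \<Rightarrow> complex) \<Rightarrow> int ^ 'n \<Rightarrow> complex" where
  "fourier_coeff u k =
     (LINT x:torus|lebesgue. u x * exp (- \<i> * of_real (vec_of_int k \<bullet> x))) / (2 * pi) ^ CARD('n)"

definition sobolev_space :: "real \<Rightarrow> (real ^ 'n::finite \<Rightarrow> complex) set" where
  "sobolev_space s = {u \<in> torus_L2.
     (\<lambda>k. (1 + (norm (vec_of_int k :: real ^ 'n))\<^sup>2) powr s * (cmod (fourier_coeff u k))\<^sup>2)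
       summable_on UNIV}"

text \<open>Meaningful on \<^const>\<open>sobolev_space\<close> only: a divergent \<^const>\<open>infsum\<close> is 0.\<close>

definition sobolev_seminorm :: "real \<Rightarrow> (real ^ 'n::finite \<Rightarrow> complex) \<Rightarrow> real" where
  "sobolev_seminorm s u = (2 * pi) powr (real CARD('n) / 2) *
     sqrt (\<Sum>\<^sub>\<infinity>k\<in>UNIV - {0}.
       norm (vec_of_int k :: real ^ 'n) powr (2 * s) * (cmod (fourier_coeff u k))\<^sup>2)"

text \<open>The integrand at \<open>x = 0\<close>, a null set, is 0 by the convention for division by zero.\<close>

definition difference_energy :: "real \<Rightarrow> (real ^ 'n::finite \<Rightarrow> complex) \<Rightarrow> ennreal" where
  "difference_energy s u =
     (\<integral>\<^sup>+y\<in>torus. (\<integral>\<^sup>+x\<in>torus.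
        ennreal ((cmod (u (x + y) - u y))\<^sup>2 / norm x powr (real CARD('n) + 2 * s)) \<partial>lebesgue) \<partial>lebesgue)"

text \<open>
  In \<open>seminorm_equivalence_constants s C1 C2 TYPE('n)\<close> the last argument only fixes the dimension.
  Finiteness of the energy is the part of the upper bound that \<^const>\<open>enn2real\<close>, which sends
  \<open>\<infinity>\<close> to 0, would lose.
\<close>

definition seminorm_equivalence_constants ::
    "real \<Rightarrow> real \<Rightarrow> real \<Rightarrow> 'n::finite itself \<Rightarrow> bool" where
  "seminorm_equivalence_constants s C1 C2 _ \<longleftrightarrow> C1 > 0 \<and> C2 > 0 \<and>
     (\<forall>u \<in> (sobolev_space s :: (real ^ 'n \<Rightarrow> complex) set).
        difference_energy s u < \<infinity> \<and>
        C1 * sobolev_seminorm s u \<le> sqrt (enn2real (difference_energy s u)) \<and>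
        sqrt (enn2real (difference_energy s u)) \<le> C2 * sobolev_seminorm s u)"

definition Phi_B :: "real \<Rightarrow> real \<Rightarrow> ('a \<Rightarrow> complex) \<Rightarrow> 'a \<Rightarrow> complex" where
  "Phi_B lam t w x =
     (if w x = 0 then 0 else exp (- \<i> * of_real (lam * t * ln ((cmod (w x))\<^sup>2))) * w x)"

end

theory Submission
  imports Defs
begin

text \<open>
The flow multiplies the value \<open>z\<close> by a phase that depends on \<open>ln ((cmod z)\<^sup>2)\<close>. The logarithm is not
Lipschitz at \<open>0\<close>, but the phase is multiplied by \<open>z\<close>: comparing two values, the increment of the
logarithm is at most the difference of the moduli divided by the smaller modulus, and the decomposition
in \<open>Phi_B_lipschitz\<close> attaches the phase difference to the value of smaller modulus, which cancels the
denominator. So the flow is a Lipschitz map of the complex plane with constant \<open>1 + 2 * \<bar>lam\<bar> * t\<close>.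
The statement on Lipschitz functions and, by integrating the squared bound, the one on the \<open>L\<^sup>2\<close> norm
follow at once.

For the Sobolev semi-norm, the difference energy only sees differences of values, so it grows at most by
the square of the Lipschitz constant (\<open>difference_energy_contraction\<close>), and the two bounds of the
equivalence translate this into the claim. The equivalence, however, is only available for functions
already known to lie in the Sobolev space. That the image lies there is a regularity statement: finite
difference energy implies summability of the weighted Fourier coefficients
(\<open>finite_energy_imp_sobolev\<close>).

To prove it, exchange the integrals in the energy. For a fixed increment \<open>x\<close>, the function
\<open>u (x + y) - u y\<close> of \<open>y\<close> has the Fourier coefficients \<open>(character k x - 1) * fourier_coeff u k\<close>, so
Bessel's inequality bounds the inner integral below, and integrating in \<open>x\<close> gives
(\<open>difference_energy_ge\<close>)
  \<open>(2 * pi) ^ d * (\<Sum>k\<in>F. (cmod (fourier_coeff u k))\<^sup>2 * character_energy s k) \<le> difference_energy s u\<close>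
for every finite \<open>F\<close>, with \<open>d\<close> the dimension. It remains to bound the weight \<open>character_energy s k\<close> from
below by a multiple of \<open>norm k powr (2 * s)\<close>. No computation is needed: up to the volume of the cell the
weight is the energy of the character itself, a member of the Sobolev space, for which the assumed
equivalence yields precisely this bound (\<open>character_energy_ge\<close>).

The Fourier analysis rests on the invariance of integrals of periodic functions over the cell under
translation (\<open>nn_integral_torus_translate\<close>), which gives both the orthogonality of the characters and
the coefficients of a translate.
\<close>

section \<open>The pointwise Lipschitz estimate\<close>

text \<open>
The flow acts on values only. Taking the identity for the function turns every pointwise fact below
into one about a fixed map of the complex plane; in particular two functions at one point can be
compared as one function at two points.
\<close>

lemma Phi_B_compose: "Phi_B lam t w x = Phi_B lam t (\<lambda>z. z) (w x)"
  by (simp add: Phi_B_def)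

lemma cmod_Phi_B [simp]: "cmod (Phi_B lam t w x) = cmod (w x)"
  by (simp add: Phi_B_def norm_mult)

text \<open>
A chord of the unit circle is no longer than the arc it subtends.
\<close>

lemma cmod_cis_diff_le: "cmod (cis a - cis b) \<le> \<bar>a - b\<bar>"
proof -
  have "cmod (cis a - cis b) = cmod (cis b * (cis (a - b) - 1))"
    by (simp add: algebra_simps cis_mult)
  also have "\<dots> = cmod (cis (a - b) - cis 0)"
    by (simp add: norm_mult)
  also have "\<dots> \<le> \<bar>a - b\<bar>"
    using dist_exp_i_1[of "a - b"] abs_sin_x_le_abs_x[of "(a - b) / 2"]
    by (simp add: cis_conv_exp dist_norm)
  finally show ?thesis .
qed

text \<open>
This is where the singularity of the logarithm at \<open>0\<close> is absorbed: its slope on \<open>[b, a]\<close> is at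
most \<open>1 / b\<close>, and that factor is cancelled by the modulus \<open>b\<close> of the smaller argument.
\<close>

lemma ln_diff_mult_le:
  fixes a b :: real
  assumes "0 < b" "b \<le> a"
  shows "\<bar>ln a - ln b\<bar> * b \<le> a - b"
proof -
  have "ln a - ln b = ln (a / b)" "0 \<le> ln (a / b)"
    using assms by (simp_all add: ln_div)
  moreover have "ln (a / b) \<le> a / b - 1"
    using assms by (intro ln_le_minus_one) simp
  ultimately have "\<bar>ln a - ln b\<bar> * b \<le> (a / b - 1) * b"
    using assms by (intro mult_right_mono) auto
  also have "\<dots> = a - b"
    using assms by (simp add: field_simps)
  finally show ?thesis .
qed

text \<open>
With \<open>A x\<close> the phase factor at \<open>x\<close>, split \<open>A x * w x - A y * w y\<close> as
\<open>A x * (w x - w y) + (A x - A y) * w y\<close>. The first term has modulus \<open>cmod (w x - w y)\<close>. In the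
second one the phase difference costs at most \<open>2 * \<bar>lam * t\<bar>\<close> times the difference of the logarithms
of the moduli, and this difference times \<open>cmod (w y)\<close> is at most \<open>cmod (w x - w y)\<close>, provided that
\<open>w y\<close> is the value of smaller modulus. By symmetry this may be assumed.
\<close>

lemma Phi_B_lipschitz:
  "cmod (Phi_B lam t w x - Phi_B lam t w y) \<le> (1 + 2 * \<bar>lam\<bar> * \<bar>t\<bar>) * cmod (w x - w y)"
proof -
  have *: "cmod (Phi_B lam t w x - Phi_B lam t w y) \<le> (1 + 2 * \<bar>lam\<bar> * \<bar>t\<bar>) * cmod (w x - w y)"
    if le: "cmod (w y) \<le> cmod (w x)" for x y
  proof (cases "w y = 0")
    case True
    have "cmod (w x) * 1 \<le> cmod (w x) * (1 + 2 * \<bar>lam\<bar> * \<bar>t\<bar>)"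
      by (intro mult_left_mono) auto
    moreover have "Phi_B lam t w y = 0"
      using True by (simp add: Phi_B_def)
    ultimately show ?thesis
      using True by (simp add: mult.commute)
  next
    case False
    define A where "A z = cis (- (lam * t * ln ((cmod (w z))\<^sup>2)))" for z
    have pos: "0 < cmod (w y)" "0 < cmod (w x)"
      using False le by (auto intro: less_le_trans)
    have Phi: "Phi_B lam t w x = A x * w x" "Phi_B lam t w y = A y * w y"
      using pos by (auto simp: Phi_B_def A_def cis_conv_exp)
    have "cmod (A x - A y) \<le> 2 * \<bar>lam\<bar> * \<bar>t\<bar> * \<bar>ln (cmod (w x)) - ln (cmod (w y))\<bar>"
    proof -
      have "cmod (A x - A y) \<le>
          \<bar>- (lam * t * ln ((cmod (w x))\<^sup>2)) - - (lam * t * ln ((cmod (w y))\<^sup>2))\<bar>"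
        unfolding A_def by (rule cmod_cis_diff_le)
      also have "\<dots> = \<bar>(- 2 * lam * t) * (ln (cmod (w x)) - ln (cmod (w y)))\<bar>"
        using pos by (simp add: ln_realpow algebra_simps)
      also have "\<dots> = 2 * \<bar>lam\<bar> * \<bar>t\<bar> * \<bar>ln (cmod (w x)) - ln (cmod (w y))\<bar>"
        by (simp add: abs_mult)
      finally show ?thesis .
    qed
    then have "cmod (A x - A y) * cmod (w y) \<le>
        2 * \<bar>lam\<bar> * \<bar>t\<bar> * (\<bar>ln (cmod (w x)) - ln (cmod (w y))\<bar> * cmod (w y))"
      using pos by (simp add: mult.assoc [symmetric])
    also have "\<dots> \<le> 2 * \<bar>lam\<bar> * \<bar>t\<bar> * cmod (w x - w y)"
      using ln_diff_mult_le[OF pos(1) le] norm_triangle_ineq2[of "w x" "w y"]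
      by (intro mult_left_mono) auto
    finally have phase: "cmod (A x - A y) * cmod (w y) \<le> 2 * \<bar>lam\<bar> * \<bar>t\<bar> * cmod (w x - w y)" .
    have "Phi_B lam t w x - Phi_B lam t w y = A x * (w x - w y) + (A x - A y) * w y"
      by (simp add: Phi algebra_simps)
    then have "cmod (Phi_B lam t w x - Phi_B lam t w y) \<le>
        cmod (A x * (w x - w y)) + cmod ((A x - A y) * w y)"
      by (metis norm_triangle_ineq)
    also have "\<dots> = cmod (w x - w y) + cmod (A x - A y) * cmod (w y)"
      by (simp add: norm_mult A_def)
    finally show ?thesis
      using phase by (simp add: algebra_simps)
  qed
  show ?thesis
    using *[of x y] *[of y x] by (cases "cmod (w y) \<le> cmod (w x)") (auto simp: norm_minus_commute)
qed

lemma continuous_on_Phi_B: "continuous_on UNIV (Phi_B lam t (\<lambda>z. z))"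
  using Phi_B_lipschitz[of lam t "\<lambda>z. z"]
  by (intro lipschitz_on_continuous_on[of "1 + 2 * \<bar>lam\<bar> * \<bar>t\<bar>"] lipschitz_onI)
     (auto simp: dist_norm)

lemma Phi_B_lipschitz_on:
  assumes "L-lipschitz_on S w"
  shows "((1 + 2 * \<bar>lam\<bar> * \<bar>t\<bar>) * L)-lipschitz_on S (Phi_B lam t w)"
proof (rule lipschitz_onI)
  fix x y assume "x \<in> S" "y \<in> S"
  have "(1 + 2 * \<bar>lam\<bar> * \<bar>t\<bar>) * dist (w x) (w y) \<le> (1 + 2 * \<bar>lam\<bar> * \<bar>t\<bar>) * (L * dist x y)"
    using lipschitz_onD[OF assms \<open>x \<in> S\<close> \<open>y \<in> S\<close>] by (intro mult_left_mono) auto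
  then show "dist (Phi_B lam t w x) (Phi_B lam t w y) \<le> (1 + 2 * \<bar>lam\<bar> * \<bar>t\<bar>) * L * dist x y"
    using Phi_B_lipschitz[of lam t w x y] by (simp add: dist_norm mult.assoc)
qed (use lipschitz_on_nonneg[OF assms] in simp)

lemma Phi_B_measurable:
  assumes "w \<in> borel_measurable M"
  shows "Phi_B lam t w \<in> borel_measurable M"
proof -
  have "(\<lambda>x. Phi_B lam t (\<lambda>z. z) (w x)) \<in> borel_measurable M"
    by (rule measurable_compose[OF assms borel_measurable_continuous_onI[OF continuous_on_Phi_B]])
  then show ?thesis
    by (simp add: Phi_B_compose[symmetric])
qed

lemma Phi_B_torus_L2: "w \<in> torus_L2 \<Longrightarrow> Phi_B lam t w \<in> torus_L2"
  by (simp add: torus_L2_def Phi_B_measurable torus_periodic_def Phi_B_compose[of lam t w])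

section \<open>Integration over the fundamental cell\<close>

text \<open>
A measure of its own, rather than a set of integration, so that the facts about finite measures apply to
the cell.
\<close>

definition torus_measure :: "(real ^ 'n::finite) measure" where
  "torus_measure = restrict_space lebesgue torus"

lemma torus_borel [measurable]: "(torus :: (real ^ 'n::finite) set) \<in> sets borel"
  unfolding torus_def by measurable

lemma torus_lebesgue [simp]: "(torus :: (real ^ 'n::finite) set) \<in> sets lebesgue"
  using torus_borel by (intro sets_completionI_sets) simp

lemma space_torus_measure [simp]: "space (torus_measure :: (real ^ 'n::finite) measure) = torus"
  by (simp add: torus_measure_def space_restrict_space)

lemma nn_integral_torus_measure:
  "(\<integral>\<^sup>+x\<in>torus. f x \<partial>lebesgue) = (\<integral>\<^sup>+x. f x \<partial>(torus_measure :: (real ^ 'n::finite) measure))"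
  unfolding torus_measure_def by (subst nn_integral_restrict_space) auto

lemma integral_torus_measure:
  fixes f :: "real ^ 'n::finite \<Rightarrow> 'b::{banach, second_countable_topology}"
  shows "(LINT x:torus|lebesgue. f x) = (\<integral>x. f x \<partial>torus_measure)"
  unfolding torus_measure_def set_lebesgue_integral_def by (subst integral_restrict_space) auto

lemma integrable_torus_measure:
  fixes f :: "real ^ 'n::finite \<Rightarrow> 'b::{banach, second_countable_topology}"
  shows "set_integrable lebesgue torus f \<longleftrightarrow> integrable torus_measure f"
  unfolding torus_measure_def set_integrable_def by (subst integrable_restrict_space) auto

lemma measurable_torus_measure:
  "f \<in> borel_measurable lebesgue \<Longrightarrow> f \<in> borel_measurable torus_measure"
  unfolding torus_measure_def by (rule measurable_restrict_space1)

text \<open>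
The half-open cell lies between an open and a closed box of the same volume.
\<close>

lemma emeasure_torus: "emeasure lebesgue (torus :: (real ^ 'n::finite) set) = ennreal ((2 * pi) ^ CARD('n))"
proof -
  let ?a = "(\<chi> i. - pi) :: real ^ 'n" and ?b = "(\<chi> i. pi) :: real ^ 'n"
  have prod: "(\<Prod>b\<in>Basis. (?b - ?a) \<bullet> b) = (2 * pi) ^ CARD('n)"
  proof -
    have "(?b - ?a) \<bullet> b = 2 * pi" if "b \<in> Basis" for b
      using that by (auto simp: Basis_vec_def inner_axis)
    then have "(\<Prod>b\<in>Basis. (?b - ?a) \<bullet> b) = (\<Prod>b\<in>(Basis :: (real ^ 'n) set). 2 * pi)"
      by (intro prod.cong) auto
    then show ?thesis
      by simp
  qed
  have le: "?a \<bullet> b \<le> ?b \<bullet> b" if "b \<in> Basis" for b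
    using that by (auto simp: Basis_vec_def inner_axis)
  have "box ?a ?b \<subseteq> torus" "torus \<subseteq> cbox ?a ?b"
    by (auto simp: torus_def mem_box_cart less_imp_le)
  then have "emeasure lborel (box ?a ?b) \<le> emeasure lborel (torus :: (real ^ 'n) set)"
    and "emeasure lborel (torus :: (real ^ 'n) set) \<le> emeasure lborel (cbox ?a ?b)"
    using torus_borel by - (rule emeasure_mono; simp)+
  then show ?thesis
    using le prod by (simp add: emeasure_lborel_box emeasure_lborel_cbox)
qed

lemma emeasure_torus_measure:
  "emeasure torus_measure (torus :: (real ^ 'n::finite) set) = ennreal ((2 * pi) ^ CARD('n))"
  unfolding torus_measure_def by (simp add: emeasure_restrict_space emeasure_torus del: emeasure_completion)

lemma finite_torus_measure: "finite_measure (torus_measure :: (real ^ 'n::finite) measure)"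
  by (rule finite_measureI) (simp add: emeasure_torus_measure)

section \<open>Translation invariance over the fundamental cell\<close>

lemma lebesgue_translation: "distr lebesgue lebesgue ((+) a) = (lebesgue :: 'a::euclidean_space measure)"
  using lebesgue_affine_euclidean[of "\<lambda>_. 1" a]
  by (simp add: euclidean_representation density_1)

lemma measurable_translate: "((+) a) \<in> lebesgue \<rightarrow>\<^sub>M (lebesgue :: 'a::euclidean_space measure)"
  using lebesgue_affine_measurable[of "\<lambda>_. 1" a]
  by (simp add: euclidean_representation)

lemma borel_measurable_translate:
  fixes f :: "'a::euclidean_space \<Rightarrow> 'b::topological_space"
  shows "f \<in> borel_measurable lebesgue \<Longrightarrow> (\<lambda>x. f (a + x)) \<in> borel_measurable lebesgue"
  by (rule measurable_compose[OF measurable_translate])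

lemma nn_integral_translate:
  fixes f :: "'a::euclidean_space \<Rightarrow> ennreal"
  assumes "f \<in> borel_measurable lebesgue"
  shows "(\<integral>\<^sup>+x. f (a + x) \<partial>lebesgue) = (\<integral>\<^sup>+x. f x \<partial>lebesgue)"
  using nn_integral_distr[OF measurable_translate, of f a] assms
  by (simp add: lebesgue_translation)

lemma lattice_translate_unique:
  fixes x :: "real ^ 'n::finite"
  shows "\<exists>!k. x + (2 * pi) *\<^sub>R vec_of_int k \<in> torus"
proof
  let ?k = "(\<chi> i. - \<lfloor>(x $ i + pi) / (2 * pi)\<rfloor>) :: int ^ 'n"
  show "x + (2 * pi) *\<^sub>R vec_of_int ?k \<in> torus"
  proof -
    have "- pi \<le> x $ i - 2 * pi * of_int \<lfloor>(x $ i + pi) / (2 * pi)\<rfloor> \<and>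
        x $ i - 2 * pi * of_int \<lfloor>(x $ i + pi) / (2 * pi)\<rfloor> < pi" for i
    proof -
      define q where "q = real_of_int \<lfloor>(x $ i + pi) / (2 * pi)\<rfloor>"
      have "q \<le> (x $ i + pi) / (2 * pi)" "(x $ i + pi) / (2 * pi) < q + 1"
        unfolding q_def by linarith+
      then have "q * (2 * pi) \<le> x $ i + pi" "x $ i + pi < (q + 1) * (2 * pi)"
        by (simp_all only: pos_le_divide_eq pos_divide_less_eq pi_gt_zero zero_less_mult_iff zero_less_numeral simp_thms)
      then show ?thesis
        unfolding q_def[symmetric] by (simp add: algebra_simps)
    qed
    then show ?thesis
      by (simp add: torus_def vec_of_int_def)
  qed
next
  fix k assume *: "x + (2 * pi) *\<^sub>R vec_of_int k \<in> torus"
  show "k = (\<chi> i. - \<lfloor>(x $ i + pi) / (2 * pi)\<rfloor>)"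
    unfolding vec_eq_iff
  proof
    fix i
    have "- pi \<le> x $ i + 2 * pi * of_int (k $ i)" "x $ i + 2 * pi * of_int (k $ i) < pi"
      using * by (simp_all add: torus_def vec_of_int_def)
    then have "\<lfloor>(x $ i + pi) / (2 * pi)\<rfloor> = - (k $ i)"
      by (intro floor_unique) (simp_all add: field_simps)
    then show "k $ i = (\<chi> i. - \<lfloor>(x $ i + pi) / (2 * pi)\<rfloor>) $ i"
      by simp
  qed
qed

lemma sum_lattice_indicator_torus:
  fixes x :: "real ^ 'n::finite"
  shows "(\<integral>\<^sup>+k. indicator torus (x + (2 * pi) *\<^sub>R vec_of_int k) \<partial>count_space UNIV) = (1 :: ennreal)"
proof -
  obtain k0 where k0: "\<And>k. x + (2 * pi) *\<^sub>R vec_of_int k \<in> torus \<longleftrightarrow> k = k0"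
    using lattice_translate_unique[of x] by blast
  have "(\<integral>\<^sup>+k. indicator torus (x + (2 * pi) *\<^sub>R vec_of_int k) \<partial>count_space UNIV)
      = (\<integral>\<^sup>+k. indicator {k0} k \<partial>count_space UNIV)"
    by (intro nn_integral_cong) (simp add: k0 indicator_def)
  then show ?thesis
    by simp
qed

lemma vec_of_int_minus: "vec_of_int (- k) = - vec_of_int k"
  by (simp add: vec_of_int_def vec_eq_iff)

text \<open>
Tile the space by the lattice translates of the cell. The integral over the shifted cell splits into
countably many pieces, one for each tile; periodicity moves every piece back into the cell, where the
pieces reassemble since each point lies in exactly one lattice translate of the shifted cell.
\<close>

lemma nn_integral_torus_translate:
  fixes f :: "real ^ 'n::finite \<Rightarrow> ennreal"
  assumes f[measurable]: "f \<in> borel_measurable lebesgue"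
    and per: "\<And>x k. f (x + (2 * pi) *\<^sub>R vec_of_int k) = f x"
  shows "(\<integral>\<^sup>+x. f (a + x) \<partial>torus_measure) = (\<integral>\<^sup>+x. f x \<partial>torus_measure)"
proof -
  let ?T = "\<lambda>k. (2 * pi) *\<^sub>R vec_of_int k :: real ^ 'n"
  let ?i = "indicator torus :: real ^ 'n \<Rightarrow> ennreal"
  have i: "(\<lambda>x. ?i (b + x)) \<in> borel_measurable lebesgue" for b
    by (rule measurable_compose[OF measurable_translate borel_measurable_indicator[OF torus_lebesgue]])
  have [measurable]: "(\<lambda>x. f x * ?i (b + x)) \<in> borel_measurable lebesgue"
    "(\<lambda>x. f x * ?i (b + x) * ?i (c + x)) \<in> borel_measurable lebesgue" for b c
    using i[of b] i[of c] f by measurable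
  have "(\<integral>\<^sup>+x. f (a + x) \<partial>torus_measure) = (\<integral>\<^sup>+x. f (a + x) * ?i (- a + (a + x)) \<partial>lebesgue)"
    by (simp add: nn_integral_torus_measure[symmetric])
  also have "\<dots> = (\<integral>\<^sup>+x. f x * ?i (- a + x) \<partial>lebesgue)"
    by (rule nn_integral_translate) measurable
  also have "\<dots> = (\<integral>\<^sup>+x. (\<integral>\<^sup>+k. f x * ?i (- a + x) * ?i (?T k + x) \<partial>count_space UNIV) \<partial>lebesgue)"
    by (simp add: nn_integral_cmult add.commute[of "?T _"] sum_lattice_indicator_torus)
  also have "\<dots> = (\<integral>\<^sup>+k. (\<integral>\<^sup>+x. f x * ?i (- a + x) * ?i (?T k + x) \<partial>lebesgue) \<partial>count_space UNIV)"
    by (rule nn_integral_count_space_nn_integral) (simp, measurable)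
  also have "\<dots> = (\<integral>\<^sup>+k. (\<integral>\<^sup>+x. f x * ?i (- a - ?T k + x) * ?i x \<partial>lebesgue) \<partial>count_space UNIV)"
  proof (rule nn_integral_cong)
    fix k
    have "(\<integral>\<^sup>+x. f x * ?i (- a + x) * ?i (?T k + x) \<partial>lebesgue)
        = (\<integral>\<^sup>+x. f (- ?T k + x) * ?i (- a + (- ?T k + x)) * ?i (?T k + (- ?T k + x)) \<partial>lebesgue)"
      by (rule nn_integral_translate[symmetric]) measurable
    also have "\<dots> = (\<integral>\<^sup>+x. f x * ?i (- a - ?T k + x) * ?i x \<partial>lebesgue)"
      using per[of _ "- k"] by (intro nn_integral_cong) (simp add: vec_of_int_minus algebra_simps)
    finally show "(\<integral>\<^sup>+x. f x * ?i (- a + x) * ?i (?T k + x) \<partial>lebesgue)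
        = (\<integral>\<^sup>+x. f x * ?i (- a - ?T k + x) * ?i x \<partial>lebesgue)" .
  qed
  also have "\<dots> = (\<integral>\<^sup>+k. (\<integral>\<^sup>+x. f x * ?i (- a - ?T (- k) + x) * ?i x \<partial>lebesgue) \<partial>count_space UNIV)"
    by (rule nn_integral_bij_count_space[symmetric]) (rule bij_uminus)
  also have "\<dots> = (\<integral>\<^sup>+x. (\<integral>\<^sup>+k. f x * ?i (- a - ?T (- k) + x) * ?i x \<partial>count_space UNIV) \<partial>lebesgue)"
  proof (rule nn_integral_count_space_nn_integral[symmetric])
    fix k
    have "(\<lambda>x. f x * ?i (- a - ?T (- k) + x) * ?i (0 + x)) \<in> borel_measurable lebesgue"
      by measurable
    then show "(\<lambda>x. f x * ?i (- a - ?T (- k) + x) * ?i x) \<in> borel_measurable lebesgue"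
      by simp
  qed auto
  also have "\<dots> = (\<integral>\<^sup>+x. (f x * ?i x) * (\<integral>\<^sup>+k. ?i ((x - a) + ?T k) \<partial>count_space UNIV) \<partial>lebesgue)"
    by (subst nn_integral_cmult[symmetric])
       (auto intro!: nn_integral_cong simp: vec_of_int_minus algebra_simps)
  also have "\<dots> = (\<integral>\<^sup>+x. f x \<partial>torus_measure)"
    by (simp only: sum_lattice_indicator_torus mult_1_right nn_integral_torus_measure)
  finally show ?thesis .
qed

text \<open>
The positive and the negative part are covered by the nonnegative case. Integrability of the translate
is assumed here; the complex case below derives it from the norm, once for both the real and the
imaginary part.
\<close>

lemma integral_torus_translate_real:
  fixes f :: "real ^ 'n::finite \<Rightarrow> real"
  assumes f[measurable]: "f \<in> borel_measurable lebesgue"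
    and per: "\<And>x k. f (x + (2 * pi) *\<^sub>R vec_of_int k) = f x"
    and int: "integrable torus_measure f" "integrable torus_measure (\<lambda>x. f (a + x))"
  shows "(\<integral>x. f (a + x) \<partial>torus_measure) = (\<integral>x. f x \<partial>torus_measure)"
proof -
  have "(\<integral>\<^sup>+x. ennreal (f (a + x)) \<partial>torus_measure) = (\<integral>\<^sup>+x. ennreal (f x) \<partial>torus_measure)"
    "(\<integral>\<^sup>+x. ennreal (- f (a + x)) \<partial>torus_measure) = (\<integral>\<^sup>+x. ennreal (- f x) \<partial>torus_measure)"
    by (rule nn_integral_torus_translate; simp add: per)+
  then show ?thesis
    by (simp add: real_lebesgue_integral_def[OF int(1)] real_lebesgue_integral_def[OF int(2)])
qed

lemma integral_torus_translate:
  fixes f :: "real ^ 'n::finite \<Rightarrow> complex"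
  assumes f[measurable]: "f \<in> borel_measurable lebesgue" and per: "torus_periodic f"
    and int: "integrable torus_measure f"
  shows "integrable torus_measure (\<lambda>x. f (a + x))"
    and "(\<integral>x. f (a + x) \<partial>torus_measure) = (\<integral>x. f x \<partial>torus_measure)"
proof -
  have per': "f (x + (2 * pi) *\<^sub>R vec_of_int k) = f x" for x k
    using per by (simp add: torus_periodic_def)
  have "(\<integral>\<^sup>+x. ennreal (norm (f (a + x))) \<partial>torus_measure) = (\<integral>\<^sup>+x. ennreal (norm (f x)) \<partial>torus_measure)"
    by (rule nn_integral_torus_translate) (simp_all add: per')
  then show int': "integrable torus_measure (\<lambda>x. f (a + x))"
    using int measurable_torus_measure[OF borel_measurable_translate[OF f, of a]]
    by (simp add: integrable_iff_bounded)
  have "(\<integral>x. Re (f (a + x)) \<partial>torus_measure) = (\<integral>x. Re (f x) \<partial>torus_measure)"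
    "(\<integral>x. Im (f (a + x)) \<partial>torus_measure) = (\<integral>x. Im (f x) \<partial>torus_measure)"
    using int int' by (intro integral_torus_translate_real; simp add: per')+
  then show "(\<integral>x. f (a + x) \<partial>torus_measure) = (\<integral>x. f x \<partial>torus_measure)"
    using int int' by (intro complex_eqI) simp_all
qed

section \<open>Fourier coefficients\<close>

definition character :: "int ^ 'n::finite \<Rightarrow> real ^ 'n \<Rightarrow> complex" where
  "character k x = cis (vec_of_int k \<bullet> x)"

lemma cmod_character [simp]: "cmod (character k x) = 1"
  by (simp add: character_def)

lemma character_0 [simp]: "character 0 x = 1"
  by (simp add: character_def vec_of_int_def inner_vec_def)

lemma character_add: "character k (a + x) = character k a * character k x"
  by (simp add: character_def inner_add_right cis_mult)

lemma character_mult_cnj: "character j x * cnj (character k x) = character (j - k) x"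
proof -
  have "vec_of_int (j - k) = vec_of_int j - vec_of_int k"
    by (simp add: vec_of_int_def vec_eq_iff)
  then show ?thesis
    by (simp add: character_def cis_cnj cis_mult inner_diff_left)
qed

lemma cnj_character: "cnj (character k x) = character (- k) x"
  using character_mult_cnj[of 0 x k] by simp

lemma torus_periodic_character: "torus_periodic (character k)"
proof -
  have "character k ((2 * pi) *\<^sub>R vec_of_int m) = 1" for m
  proof -
    have "vec_of_int k \<bullet> ((2 * pi) *\<^sub>R vec_of_int m) = 2 * pi * of_int (\<Sum>i\<in>UNIV. k $ i * m $ i)"
      by (simp add: vec_of_int_def inner_vec_def sum_distrib_left mult.assoc mult.left_commute)
    then show ?thesis
      unfolding character_def by (simp only: cis_multiple_2pi Ints_of_int)
  qed
  then show ?thesis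
    by (simp add: torus_periodic_def add.commute[of _ "(2 * pi) *\<^sub>R _"] character_add)
qed

lemma continuous_on_character: "continuous_on A (character k)"
  unfolding character_def[abs_def] cis_conv_exp by (intro continuous_intros)

lemma character_measurable [measurable]: "character k \<in> borel_measurable borel"
  by (intro borel_measurable_continuous_onI continuous_on_character)

lemma character_measurable_lebesgue [measurable]: "character k \<in> borel_measurable lebesgue"
  by (rule measurable_completion) simp

lemma character_measurable_torus [measurable]: "character k \<in> borel_measurable torus_measure"
  by (rule measurable_torus_measure) simp

lemma integrable_character [simp]: "integrable torus_measure (character k)"
  by (rule finite_measure.integrable_const_bound[OF finite_torus_measure, of _ 1]) auto

text \<open>
For \<open>k \<noteq> 0\<close> some translation multiplies the character by \<open>- 1\<close>; as it leaves the integral unchanged,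
the integral vanishes.
\<close>

lemma integral_character:
  fixes k :: "int ^ 'n::finite"
  shows "(\<integral>x. character k x \<partial>torus_measure) = (if k = 0 then (2 * pi) ^ CARD('n) else 0)"
proof (cases "k = 0")
  case True
  then show ?thesis
    by (simp add: measure_def emeasure_torus_measure scaleR_conv_of_real)
next
  case False
  then obtain i where i: "k $ i \<noteq> 0"
    by (auto simp: vec_eq_iff)
  \<comment> \<open>The step is chosen such that the inner product with the frequency is \<open>pi\<close>.\<close>
  define a :: "real ^ 'n" where "a = axis i (pi / k $ i)"
  have "character k a = - 1"
    using i by (simp add: character_def a_def inner_axis vec_of_int_def)
  moreover have "(\<integral>x. character k (a + x) \<partial>torus_measure) = (\<integral>x. character k x \<partial>torus_measure)"
    by (rule integral_torus_translate) (simp_all add: torus_periodic_character)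
  ultimately have "- (\<integral>x. character k x \<partial>torus_measure) = (\<integral>x. character k x \<partial>torus_measure)"
    by (simp add: character_add)
  then show ?thesis
    using False by simp
qed

lemma fourier_coeff_eq:
  fixes u :: "real ^ 'n::finite \<Rightarrow> complex"
  shows "fourier_coeff u k = (\<integral>x. u x * cnj (character k x) \<partial>torus_measure) / (2 * pi) ^ CARD('n)"
proof -
  have "exp (- \<i> * of_real r) = cnj (cis r)" for r
    by (simp add: cis_cnj) (simp add: cis_conv_exp)
  then show ?thesis
    by (simp add: fourier_coeff_def integral_torus_measure character_def)
qed

lemma fourier_coeff_character: "fourier_coeff (character j) k = (if j = k then 1 else 0)"
  by (simp add: fourier_coeff_eq character_mult_cnj integral_character)

lemma torus_L2_iff:
  "u \<in> torus_L2 \<longleftrightarrow> torus_periodic u \<and> u \<in> borel_measurable lebesgue \<and>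
    integrable torus_measure (\<lambda>x. (cmod (u x))\<^sup>2)"
  by (simp add: torus_L2_def integrable_torus_measure)

text \<open>
On a finite measure space, square integrability dominates integrability: \<open>r \<le> 1 + r\<^sup>2\<close>.
\<close>

lemma integrable_torus_L2:
  assumes "u \<in> torus_L2"
  shows "integrable torus_measure u"
proof (rule Bochner_Integration.integrable_bound)
  show "integrable torus_measure (\<lambda>x. 1 + (cmod (u x))\<^sup>2)"
    using assms finite_measure.integrable_const[OF finite_torus_measure]
    by (intro Bochner_Integration.integrable_add) (simp_all add: torus_L2_iff)
  show "u \<in> borel_measurable torus_measure"
    using assms by (simp add: torus_L2_iff measurable_torus_measure)
  have "r \<le> 1 + r\<^sup>2" for r :: real
    using sum_squares_ge_zero[of "r - 1 / 2" 0] by (simp add: power2_eq_square algebra_simps)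
  then show "AE x in torus_measure. norm (u x) \<le> norm (1 + (cmod (u x))\<^sup>2)"
    by (auto simp: add_nonneg_nonneg abs_of_nonneg)
qed

lemma torus_L2_translate:
  assumes "u \<in> torus_L2"
  shows "(\<lambda>x. u (a + x)) \<in> torus_L2"
proof -
  let ?f = "\<lambda>x. complex_of_real ((cmod (u x))\<^sup>2)"
  have u[measurable]: "u \<in> borel_measurable lebesgue" and per: "\<And>x k. u (x + (2 * pi) *\<^sub>R vec_of_int k) = u x"
    and int: "integrable torus_measure (\<lambda>x. (cmod (u x))\<^sup>2)"
    using assms by (auto simp: torus_L2_iff torus_periodic_def)
  have "integrable torus_measure (\<lambda>x. ?f (a + x))"
  proof (rule integral_torus_translate)
    show "integrable torus_measure ?f"
      by (rule integrable_of_real[OF int])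
  qed (simp_all add: torus_periodic_def per)
  then have "integrable torus_measure (\<lambda>x. (cmod (u (a + x)))\<^sup>2)"
    by (simp only: complex_of_real_integrable_eq)
  then show ?thesis
    by (simp add: torus_L2_iff torus_periodic_def borel_measurable_translate[OF u] per add.assoc[symmetric])
qed

lemma torus_L2_diff:
  assumes "u \<in> torus_L2" "v \<in> torus_L2"
  shows "(\<lambda>x. u x - v x) \<in> torus_L2"
proof -
  have [measurable]: "u \<in> borel_measurable lebesgue" "v \<in> borel_measurable lebesgue"
    and int: "integrable torus_measure (\<lambda>x. (cmod (u x))\<^sup>2)" "integrable torus_measure (\<lambda>x. (cmod (v x))\<^sup>2)"
    using assms by (auto simp: torus_L2_iff)
  have le: "(cmod (a - b))\<^sup>2 \<le> 2 * (cmod a)\<^sup>2 + 2 * (cmod b)\<^sup>2" for a b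
  proof -
    have "(cmod (a - b))\<^sup>2 \<le> (cmod a + cmod b)\<^sup>2"
      by (intro power_mono norm_triangle_ineq4) simp
    also have "\<dots> \<le> 2 * (cmod a)\<^sup>2 + 2 * (cmod b)\<^sup>2"
      using zero_le_power2[of "cmod a - cmod b"] by (simp add: power2_eq_square algebra_simps)
    finally show ?thesis .
  qed
  have "integrable torus_measure (\<lambda>x. (cmod (u x - v x))\<^sup>2)"
  proof (rule Bochner_Integration.integrable_bound)
    show "integrable torus_measure (\<lambda>x. 2 * (cmod (u x))\<^sup>2 + 2 * (cmod (v x))\<^sup>2)"
      using int by simp
    show "(\<lambda>x. (cmod (u x - v x))\<^sup>2) \<in> borel_measurable torus_measure"
      by (rule measurable_torus_measure) measurable
  qed (auto intro: order_trans[OF le])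
  then show ?thesis
    using assms by (simp add: torus_L2_iff torus_periodic_def)
qed

lemma integrable_mult_character:
  assumes "integrable torus_measure u"
  shows "integrable torus_measure (\<lambda>x. u x * cnj (character k x))"
proof (rule Bochner_Integration.integrable_bound[OF assms])
  show "(\<lambda>x. u x * cnj (character k x)) \<in> borel_measurable torus_measure"
    using borel_measurable_integrable[OF assms] by (simp add: cnj_character)
qed (auto simp: norm_mult)

lemma fourier_coeff_translate:
  assumes u: "u \<in> torus_L2"
  shows "fourier_coeff (\<lambda>x. u (a + x)) k = character k a * fourier_coeff u k"
proof -
  let ?f = "\<lambda>x. u x * cnj (character k x)"
  have [measurable]: "u \<in> borel_measurable lebesgue"
    using u by (simp add: torus_L2_iff)
  have [measurable]: "(\<lambda>x. cnj (character k x)) \<in> borel_measurable lebesgue"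
    by (simp add: cnj_character)
  have "?f \<in> borel_measurable lebesgue"
    by measurable
  then have "(\<integral>x. ?f (a + x) \<partial>torus_measure) = (\<integral>x. ?f x \<partial>torus_measure)"
    using u torus_periodic_character[of k]
    by (intro integral_torus_translate integrable_mult_character integrable_torus_L2)
       (auto simp: torus_periodic_def torus_L2_iff)
  moreover have shift: "u (a + x) * cnj (character k x) = character k a * ?f (a + x)" for x
  proof -
    have "character k a * cnj (character k a) = 1"
      by (simp add: character_mult_cnj)
    then show ?thesis
      by (simp add: character_add algebra_simps)
  qed
  ultimately have "(\<integral>x. u (a + x) * cnj (character k x) \<partial>torus_measure)
      = character k a * (\<integral>x. ?f x \<partial>torus_measure)"
    unfolding shift by simp
  then show ?thesis
    by (simp add: fourier_coeff_eq)
qed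

lemma fourier_coeff_difference:
  assumes u: "u \<in> torus_L2"
  shows "fourier_coeff (\<lambda>x. u (a + x) - u x) k = (character k a - 1) * fourier_coeff u k"
proof -
  have "fourier_coeff (\<lambda>x. u (a + x) - u x) k = fourier_coeff (\<lambda>x. u (a + x)) k - fourier_coeff u k"
    using integrable_mult_character[OF integrable_torus_L2[OF u]]
      integrable_mult_character[OF integrable_torus_L2[OF torus_L2_translate[OF u]]]
    by (simp add: fourier_coeff_eq left_diff_distrib diff_divide_distrib)
  then show ?thesis
    by (simp add: fourier_coeff_translate[OF u] left_diff_distrib)
qed

text \<open>
Expand the square of the norm of \<open>u - p\<close>, where \<open>p\<close> is the partial Fourier sum over \<open>F\<close>. On \<open>F\<close> the
functions \<open>u\<close> and \<open>p\<close> have the same coefficients, hence the same inner product with \<open>p\<close>, so what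
remains after the expansion is the difference of the two sides.
\<close>

lemma Bessel_inequality:
  fixes u :: "real ^ 'n::finite \<Rightarrow> complex"
  assumes u: "u \<in> torus_L2" and F: "finite F"
  shows "(2 * pi) ^ CARD('n) * (\<Sum>k\<in>F. (cmod (fourier_coeff u k))\<^sup>2) \<le> (\<integral>x. (cmod (u x))\<^sup>2 \<partial>torus_measure)"
proof -
  let ?c = "(2 * pi) ^ CARD('n) :: real"
  define p where "p x = (\<Sum>k\<in>F. fourier_coeff u k * character k x)" for x
  have int_u: "integrable torus_measure u"
    by (rule integrable_torus_L2[OF u])
  have int_p: "integrable torus_measure p"
    unfolding p_def by (intro Bochner_Integration.integrable_sum integrable_mult_right integrable_character)
  have u_coeff: "(\<integral>x. u x * cnj (character k x) \<partial>torus_measure) = ?c * fourier_coeff u k" for k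
    by (simp add: fourier_coeff_eq)
  have p_coeff: "(\<integral>x. p x * cnj (character k x) \<partial>torus_measure) = ?c * fourier_coeff u k" if "k \<in> F" for k
  proof -
    have "(\<integral>x. p x * cnj (character k x) \<partial>torus_measure)
        = (\<integral>x. (\<Sum>j\<in>F. fourier_coeff u j * character (j - k) x) \<partial>torus_measure)"
      by (simp add: p_def sum_distrib_right mult.assoc character_mult_cnj)
    also have "\<dots> = (\<Sum>j\<in>F. fourier_coeff u j * (\<integral>x. character (j - k) x \<partial>torus_measure))"
      by (subst Bochner_Integration.integral_sum) simp_all
    also have "\<dots> = (\<Sum>j\<in>F. if j = k then ?c * fourier_coeff u k else 0)"
      by (intro sum.cong) (auto simp: integral_character)
    also have "\<dots> = ?c * fourier_coeff u k"
      using F that by simp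
    finally show ?thesis .
  qed
  have coeff_term: "integrable torus_measure (\<lambda>x. cnj (fourier_coeff u k) * (f x * cnj (character k x)))"
    if "integrable torus_measure f" for f k
    by (intro integrable_mult_right integrable_mult_character that)
  have expand: "f x * cnj (p x) = (\<Sum>k\<in>F. cnj (fourier_coeff u k) * (f x * cnj (character k x)))" for f x
    by (simp add: p_def sum_distrib_left algebra_simps)
  have int_mult_p: "integrable torus_measure (\<lambda>x. f x * cnj (p x))" if "integrable torus_measure f" for f
    unfolding expand by (intro Bochner_Integration.integrable_sum coeff_term that)
  have mult_p: "(\<integral>x. f x * cnj (p x) \<partial>torus_measure) = ?c * (\<Sum>k\<in>F. (cmod (fourier_coeff u k))\<^sup>2)"
    if "integrable torus_measure f"
      and "\<And>k. k \<in> F \<Longrightarrow> (\<integral>x. f x * cnj (character k x) \<partial>torus_measure) = ?c * fourier_coeff u k" for f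
  proof -
    have "(\<integral>x. f x * cnj (p x) \<partial>torus_measure)
        = (\<Sum>k\<in>F. cnj (fourier_coeff u k) * (\<integral>x. f x * cnj (character k x) \<partial>torus_measure))"
      unfolding expand using coeff_term[OF that(1)] by (subst Bochner_Integration.integral_sum) simp_all
    also have "\<dots> = (\<Sum>k\<in>F. ?c * (fourier_coeff u k * cnj (fourier_coeff u k)))"
      using that(2) by (intro sum.cong) (simp_all add: mult_ac)
    also have "\<dots> = ?c * (\<Sum>k\<in>F. (cmod (fourier_coeff u k))\<^sup>2)"
      by (simp add: complex_norm_square[symmetric] sum_distrib_left)
    finally show ?thesis .
  qed
  have up: "has_bochner_integral torus_measure (\<lambda>x. u x * cnj (p x)) (?c * (\<Sum>k\<in>F. (cmod (fourier_coeff u k))\<^sup>2))"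
    using mult_p[OF int_u u_coeff] int_mult_p[OF int_u] by (simp add: has_bochner_integral_iff)
  have pp: "has_bochner_integral torus_measure (\<lambda>x. p x * cnj (p x)) (?c * (\<Sum>k\<in>F. (cmod (fourier_coeff u k))\<^sup>2))"
    using mult_p[OF int_p p_coeff] int_mult_p[OF int_p] by (simp add: has_bochner_integral_iff)
  have uu: "has_bochner_integral torus_measure (\<lambda>x. (cmod (u x))\<^sup>2) (\<integral>x. (cmod (u x))\<^sup>2 \<partial>torus_measure)"
    using u by (simp add: has_bochner_integral_iff torus_L2_iff)
  have two_up: "has_bochner_integral torus_measure (\<lambda>x. 2 * Re (u x * cnj (p x)))
      (2 * Re (of_real (?c * (\<Sum>k\<in>F. (cmod (fourier_coeff u k))\<^sup>2))))"
    by (rule has_bochner_integral_mult_right) (rule has_bochner_integral_Re[OF up])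
  have "(cmod (u x - p x))\<^sup>2 = (cmod (u x))\<^sup>2 - 2 * Re (u x * cnj (p x)) + Re (p x * cnj (p x))" for x
    unfolding cmod_power2 by (simp add: power2_eq_square algebra_simps)
  then have up_diff: "has_bochner_integral torus_measure (\<lambda>x. (cmod (u x - p x))\<^sup>2)
      ((\<integral>x. (cmod (u x))\<^sup>2 \<partial>torus_measure) - 2 * (?c * (\<Sum>k\<in>F. (cmod (fourier_coeff u k))\<^sup>2))
         + ?c * (\<Sum>k\<in>F. (cmod (fourier_coeff u k))\<^sup>2))"
    using has_bochner_integral_add[OF has_bochner_integral_diff[OF uu two_up] has_bochner_integral_Re[OF pp]]
    by simp
  have "0 \<le> (\<integral>x. (cmod (u x - p x))\<^sup>2 \<partial>torus_measure)"
    by simp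
  then have "0 \<le> (\<integral>x. (cmod (u x))\<^sup>2 \<partial>torus_measure) - 2 * (?c * (\<Sum>k\<in>F. (cmod (fourier_coeff u k))\<^sup>2))
         + ?c * (\<Sum>k\<in>F. (cmod (fourier_coeff u k))\<^sup>2)"
    unfolding has_bochner_integral_integral_eq[OF up_diff] .
  then show ?thesis
    by linarith
qed

section \<open>The difference energy\<close>

text \<open>
Tonelli's theorem needs joint measurability of \<open>u (x + y)\<close>, which may fail for merely Lebesgue measurable
\<open>u\<close> with respect to the product of two completed measures. A Borel function that agrees with \<open>u\<close>
almost everywhere repairs this.
\<close>

lemma borel_representative:
  fixes u :: "'a::euclidean_space \<Rightarrow> complex"
  assumes "u \<in> borel_measurable lebesgue"
  obtains u' where "u' \<in> borel_measurable borel" "AE x in lebesgue. u x = u' x"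
proof -
  have "(\<lambda>x. Re (u x)) \<in> borel_measurable lebesgue" "(\<lambda>x. Im (u x)) \<in> borel_measurable lebesgue"
    using assms by simp_all
  then obtain f g where f: "f \<in> borel_measurable lborel" "AE x in lborel. Re (u x) = f x"
    and g: "g \<in> borel_measurable lborel" "AE x in lborel. Im (u x) = g x"
    using completion_ex_borel_measurable_real by metis
  show thesis
  proof (rule that)
    show "(\<lambda>x. Complex (f x) (g x)) \<in> borel_measurable borel"
      using f(1) g(1) by (simp add: Complex_eq)
    show "AE x in lebesgue. u x = Complex (f x) (g x)"
      using f(2) g(2) by (auto simp: AE_completion_iff complex_eq_iff)
  qed
qed

lemma AE_lebesgue_translate:
  fixes a :: "'a::euclidean_space"
  assumes "AE x in lebesgue. P x"
  shows "AE x in lebesgue. P (a + x)"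
proof -
  have "AE x in distr lebesgue lebesgue ((+) a). P x"
    unfolding lebesgue_translation by (rule assms)
  then show ?thesis
    by (rule AE_distrD[OF measurable_translate])
qed

text \<open>
The inner integral of the energy once the order of integration is exchanged.
\<close>

definition difference_norm2 :: "(real ^ 'n::finite \<Rightarrow> complex) \<Rightarrow> real ^ 'n \<Rightarrow> ennreal" where
  "difference_norm2 u x = (\<integral>\<^sup>+y. ennreal ((cmod (u (x + y) - u y))\<^sup>2) \<partial>torus_measure)"

definition difference_kernel :: "real \<Rightarrow> real ^ 'n::finite \<Rightarrow> ennreal" where
  "difference_kernel s x = ennreal (inverse (norm x powr (real CARD('n) + 2 * s)))"

lemma difference_kernel_measurable [measurable]: "difference_kernel s \<in> borel_measurable borel"
  unfolding difference_kernel_def[abs_def] by measurable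

lemma difference_kernel_measurable_torus [measurable]: "difference_kernel s \<in> borel_measurable torus_measure"
  by (intro measurable_torus_measure measurable_completion) simp

lemma difference_energy_eq:
  fixes u :: "real ^ 'n::finite \<Rightarrow> complex"
  shows "difference_energy s u = (\<integral>\<^sup>+y. (\<integral>\<^sup>+x. ennreal ((cmod (u (x + y) - u y))\<^sup>2) * difference_kernel s x \<partial>torus_measure) \<partial>torus_measure)"
  by (simp add: difference_energy_def nn_integral_torus_measure difference_kernel_def divide_inverse ennreal_mult)

lemma nn_integral_torus_lborel:
  "(\<integral>\<^sup>+x. f x \<partial>torus_measure) = (\<integral>\<^sup>+x. f x * indicator torus x \<partial>lborel)"
  by (simp add: nn_integral_torus_measure[symmetric] nn_integral_completion)

lemma AE_torus_measure: "AE x in lebesgue. P x \<Longrightarrow> AE x in torus_measure. P x"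
  unfolding torus_measure_def by (subst AE_restrict_space_iff) auto

text \<open>
Tonelli's theorem for a Borel representative \<open>v\<close> of \<open>u\<close>. Null sets are invariant under translation, so
\<open>v\<close> may replace \<open>u\<close> inside either inner integral.
\<close>

lemma
  fixes u :: "real ^ 'n::finite \<Rightarrow> complex"
  assumes u: "u \<in> borel_measurable lebesgue"
  shows difference_norm2_measurable: "difference_norm2 u \<in> borel_measurable torus_measure"
    and difference_energy_swap: "difference_energy s u = (\<integral>\<^sup>+x. difference_norm2 u x * difference_kernel s x \<partial>torus_measure)"
proof -
  obtain v where v[measurable]: "v \<in> borel_measurable borel" and ae: "AE x in lebesgue. u x = v x"
    using borel_representative[OF u] .
  let ?f = "\<lambda>x y. ennreal ((cmod (v (x + y) - v y))\<^sup>2)"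
  have norm2_v: "difference_norm2 u x = (\<integral>\<^sup>+y. ?f x y * indicator torus y \<partial>lborel)" for x
    unfolding difference_norm2_def nn_integral_torus_lborel[symmetric]
    using AE_torus_measure[OF AE_lebesgue_translate[OF ae, of x]] AE_torus_measure[OF ae]
    by (intro nn_integral_cong_AE) auto
  have "(\<lambda>x. \<integral>\<^sup>+y. ?f x y * indicator torus y \<partial>lborel) \<in> borel_measurable borel"
    by measurable
  then have meas: "difference_norm2 u \<in> borel_measurable borel"
    unfolding norm2_v[abs_def] .
  then show "difference_norm2 u \<in> borel_measurable torus_measure"
    by (intro measurable_torus_measure measurable_completion) simp
  define g where "g x y = ?f x y * difference_kernel s x * indicator torus x * indicator torus y" for x y
  have g_measurable [measurable]: "case_prod g \<in> borel_measurable (lborel \<Otimes>\<^sub>M lborel)"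
    unfolding g_def by measurable
  have "difference_energy s u = (\<integral>\<^sup>+y. (\<integral>\<^sup>+x. ?f x y * difference_kernel s x \<partial>torus_measure) \<partial>torus_measure)"
    unfolding difference_energy_eq
  proof (rule nn_integral_cong_AE, use AE_torus_measure[OF ae] in eventually_elim)
    case (elim y)
    have "AE x in torus_measure. u (x + y) = v (x + y)"
      using AE_torus_measure[OF AE_lebesgue_translate[OF ae, of y]] by (simp add: add.commute)
    then show ?case
      using elim by (intro nn_integral_cong_AE) auto
  qed
  also have "\<dots> = (\<integral>\<^sup>+y. (\<integral>\<^sup>+x. g x y \<partial>lborel) \<partial>lborel)"
    unfolding nn_integral_torus_lborel g_def
    by (rule nn_integral_cong, rule nn_integral_multc[symmetric]) measurable
  also have "\<dots> = (\<integral>\<^sup>+x. (\<integral>\<^sup>+y. g x y \<partial>lborel) \<partial>lborel)"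
    by (rule lborel_pair.Fubini'[OF g_measurable])
  also have "\<dots> = (\<integral>\<^sup>+x. difference_norm2 u x * difference_kernel s x \<partial>torus_measure)"
    unfolding nn_integral_torus_lborel
  proof (rule nn_integral_cong)
    fix x
    have "(\<integral>\<^sup>+y. g x y \<partial>lborel) = (\<integral>\<^sup>+y. ?f x y * indicator torus y * (difference_kernel s x * indicator torus x) \<partial>lborel)"
      by (rule nn_integral_cong) (simp only: g_def mult_ac)
    also have "\<dots> = difference_norm2 u x * (difference_kernel s x * indicator torus x)"
      unfolding norm2_v by (rule nn_integral_multc) measurable
    finally show "(\<integral>\<^sup>+y. g x y \<partial>lborel) = difference_norm2 u x * difference_kernel s x * indicator torus x"
      by (simp only: mult.assoc)
  qed
  finally show "difference_energy s u = (\<integral>\<^sup>+x. difference_norm2 u x * difference_kernel s x \<partial>torus_measure)" .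
qed

text \<open>
The energy depends on its argument only through differences of values, so it contracts under any
pointwise domination of these.
\<close>

lemma difference_energy_contraction:
  assumes u: "u \<in> borel_measurable lebesgue" and v: "v \<in> borel_measurable lebesgue"
    and le: "\<And>x y. cmod (v x - v y) \<le> K * cmod (u x - u y)"
  shows "difference_energy s v \<le> ennreal (K\<^sup>2) * difference_energy s u"
proof -
  have norm2: "difference_norm2 v x \<le> ennreal (K\<^sup>2) * difference_norm2 u x" for x
  proof -
    have [measurable]: "(\<lambda>y. u (x + y)) \<in> borel_measurable torus_measure" "u \<in> borel_measurable torus_measure"
      by (intro measurable_torus_measure borel_measurable_translate u)+
    have "(cmod (v (x + y) - v y))\<^sup>2 \<le> K\<^sup>2 * (cmod (u (x + y) - u y))\<^sup>2" for y
      using power_mono[OF le, of "x + y" y 2] by (simp add: power_mult_distrib)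
    then have "difference_norm2 v x \<le> (\<integral>\<^sup>+y. ennreal (K\<^sup>2) * ennreal ((cmod (u (x + y) - u y))\<^sup>2) \<partial>torus_measure)"
      unfolding difference_norm2_def by (intro nn_integral_mono) (simp add: ennreal_mult[symmetric] ennreal_leI)
    also have "\<dots> = ennreal (K\<^sup>2) * difference_norm2 u x"
      unfolding difference_norm2_def by (rule nn_integral_cmult) measurable
    finally show ?thesis .
  qed
  note [measurable] = difference_norm2_measurable[OF u]
  have "difference_energy s v \<le> (\<integral>\<^sup>+x. ennreal (K\<^sup>2) * (difference_norm2 u x * difference_kernel s x) \<partial>torus_measure)"
    unfolding difference_energy_swap[OF v] mult.assoc[symmetric]
    by (intro nn_integral_mono mult_right_mono norm2) simp
  also have "\<dots> = ennreal (K\<^sup>2) * difference_energy s u"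
    unfolding difference_energy_swap[OF u] by (rule nn_integral_cmult) measurable
  finally show ?thesis .
qed

text \<open>
Up to the volume of the cell, this is the difference energy of a single character. The same weight
appears in front of \<open>(cmod (fourier_coeff u k))\<^sup>2\<close> in the energy of a general \<open>u\<close>, so a bound on the
energies of the characters controls all functions.
\<close>

definition character_energy :: "real \<Rightarrow> int ^ 'n::finite \<Rightarrow> ennreal" where
  "character_energy s k = (\<integral>\<^sup>+x. ennreal ((cmod (character k x - 1))\<^sup>2) * difference_kernel s x \<partial>torus_measure)"

lemma difference_energy_character:
  fixes k :: "int ^ 'n::finite"
  shows "difference_energy s (character k) = ennreal ((2 * pi) ^ CARD('n)) * character_energy s k"
proof -
  have "cmod (character k (x + y) - character k y) = cmod (character k x - 1)" for x y
  proof -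
    have "character k (x + y) - character k y = (character k x - 1) * character k y"
      by (simp add: character_add algebra_simps)
    then show ?thesis
      by (simp add: norm_mult)
  qed
  then show ?thesis
    by (simp add: difference_energy_eq character_energy_def emeasure_torus_measure mult.commute)
qed

text \<open>
Bessel's inequality for the increment \<open>u (x + y) - u y\<close> as a function of \<open>y\<close>: its coefficients are those
of \<open>u\<close> multiplied by \<open>character k x - 1\<close>.
\<close>

lemma difference_norm2_ge:
  fixes u :: "real ^ 'n::finite \<Rightarrow> complex"
  assumes u: "u \<in> torus_L2" and F: "finite F"
  shows "(\<Sum>k\<in>F. ennreal ((2 * pi) ^ CARD('n) * (cmod (fourier_coeff u k))\<^sup>2) * ennreal ((cmod (character k x - 1))\<^sup>2))
    \<le> difference_norm2 u x"
proof -
  have L2: "(\<lambda>y. u (x + y) - u y) \<in> torus_L2"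
    by (intro torus_L2_diff torus_L2_translate u)
  have "(\<Sum>k\<in>F. ennreal ((2 * pi) ^ CARD('n) * (cmod (fourier_coeff u k))\<^sup>2) * ennreal ((cmod (character k x - 1))\<^sup>2))
      = ennreal ((2 * pi) ^ CARD('n) * (\<Sum>k\<in>F. (cmod (fourier_coeff (\<lambda>y. u (x + y) - u y) k))\<^sup>2))"
    by (simp add: fourier_coeff_difference[OF u] norm_mult power_mult_distrib sum_distrib_left
        ennreal_mult[symmetric] sum_ennreal mult_ac)
  also have "\<dots> \<le> ennreal (\<integral>y. (cmod (u (x + y) - u y))\<^sup>2 \<partial>torus_measure)"
    by (intro ennreal_leI Bessel_inequality[OF L2 F])
  also have "\<dots> = difference_norm2 u x"
    unfolding difference_norm2_def
    using L2 by (intro nn_integral_eq_integral[symmetric]) (auto simp: torus_L2_iff)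
  finally show ?thesis .
qed

lemma difference_energy_ge:
  fixes u :: "real ^ 'n::finite \<Rightarrow> complex"
  assumes u: "u \<in> torus_L2" and F: "finite F"
  shows "(\<Sum>k\<in>F. ennreal ((2 * pi) ^ CARD('n) * (cmod (fourier_coeff u k))\<^sup>2) * character_energy s k)
    \<le> difference_energy s u"
proof -
  have meas: "u \<in> borel_measurable lebesgue"
    using u by (simp add: torus_L2_iff)
  have "(\<Sum>k\<in>F. ennreal ((2 * pi) ^ CARD('n) * (cmod (fourier_coeff u k))\<^sup>2) * character_energy s k)
      = (\<integral>\<^sup>+x. (\<Sum>k\<in>F. ennreal ((2 * pi) ^ CARD('n) * (cmod (fourier_coeff u k))\<^sup>2)
          * ennreal ((cmod (character k x - 1))\<^sup>2)) * difference_kernel s x \<partial>torus_measure)"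
    unfolding character_energy_def
    by (simp add: nn_integral_cmult[symmetric] nn_integral_sum[symmetric] sum_distrib_right mult.assoc)
  also have "\<dots> \<le> difference_energy s u"
    unfolding difference_energy_swap[OF meas]
    by (intro nn_integral_mono mult_right_mono difference_norm2_ge u F) simp
  finally show ?thesis .
qed

section \<open>Finite energy gives Sobolev regularity\<close>

lemma norm_vec_of_int_ge_1:
  assumes "k \<noteq> 0"
  shows "1 \<le> norm (vec_of_int k :: real ^ 'n::finite)"
proof -
  obtain i where "k $ i \<noteq> 0"
    using assms by (auto simp: vec_eq_iff)
  then have "1 \<le> \<bar>real_of_int (k $ i)\<bar>"
    by linarith
  also have "\<dots> = \<bar>(vec_of_int k :: real ^ 'n) $ i\<bar>"
    by (simp add: vec_of_int_def)
  also have "\<dots> \<le> norm (vec_of_int k :: real ^ 'n)"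
    by (rule component_le_norm_cart)
  finally show ?thesis .
qed

lemma character_in_sobolev_space:
  fixes k :: "int ^ 'n::finite"
  shows "character k \<in> sobolev_space s"
proof -
  have "character k \<in> torus_L2"
    using finite_measure.integrable_const[OF finite_torus_measure]
    by (simp add: torus_L2_iff torus_periodic_character)
  moreover have "(\<lambda>j. (1 + (norm (vec_of_int j :: real ^ 'n))\<^sup>2) powr s * (cmod (fourier_coeff (character k) j))\<^sup>2)
      summable_on UNIV \<longleftrightarrow>
      (\<lambda>j. (1 + (norm (vec_of_int j :: real ^ 'n))\<^sup>2) powr s * (cmod (fourier_coeff (character k) j))\<^sup>2)
      summable_on {k}"
    by (rule summable_on_cong_neutral) (auto simp: fourier_coeff_character)
  ultimately show ?thesis
    by (simp add: sobolev_space_def)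
qed

lemma sobolev_seminorm_character:
  fixes k :: "int ^ 'n::finite"
  assumes "k \<noteq> 0"
  shows "sobolev_seminorm s (character k) = (2 * pi) powr (real CARD('n) / 2) * norm (vec_of_int k :: real ^ 'n) powr s"
proof -
  have "(\<Sum>\<^sub>\<infinity>j\<in>UNIV - {0}. norm (vec_of_int j :: real ^ 'n) powr (2 * s) * (cmod (fourier_coeff (character k) j))\<^sup>2)
      = (\<Sum>\<^sub>\<infinity>j\<in>{k}. norm (vec_of_int j :: real ^ 'n) powr (2 * s))"
    using assms by (intro infsum_cong_neutral) (auto simp: fourier_coeff_character)
  also have "\<dots> = (norm (vec_of_int k :: real ^ 'n) powr s)\<^sup>2"
    by (simp add: powr_add[symmetric] power2_eq_square)
  finally show ?thesis
    by (simp add: sobolev_seminorm_def)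
qed

lemma powr_half_square: "0 < b \<Longrightarrow> (b powr (real n / 2))\<^sup>2 = b ^ n"
  by (simp add: power2_eq_square powr_add[symmetric] powr_realpow)

text \<open>
The equivalence of semi-norms is assumed on the Sobolev space only, but the characters belong to that
space and their semi-norm is explicit. Applied to them, its lower bound becomes an estimate for
integrals that involve the frequency alone.
\<close>

lemma character_energy_ge:
  fixes k :: "int ^ 'n::finite"
  assumes "seminorm_equivalence_constants s C1 C2 TYPE('n)" "k \<noteq> 0"
  shows "ennreal (C1\<^sup>2 * norm (vec_of_int k :: real ^ 'n) powr (2 * s)) \<le> character_energy s k"
proof -
  let ?c = "(2 * pi) ^ CARD('n) :: real" and ?E = "difference_energy s (character k)"
  have C1: "0 < C1" and fin: "?E < \<infinity>" and le: "C1 * sobolev_seminorm s (character k) \<le> sqrt (enn2real ?E)"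
    using assms(1) character_in_sobolev_space by (auto simp: seminorm_equivalence_constants_def)
  have "0 \<le> C1 * sobolev_seminorm s (character k)"
    using C1 by (simp add: sobolev_seminorm_character[OF assms(2)])
  then have "(C1 * sobolev_seminorm s (character k))\<^sup>2 \<le> enn2real ?E"
    using power_mono[OF le, of 2] by simp
  moreover have "(C1 * sobolev_seminorm s (character k))\<^sup>2 = ?c * (C1\<^sup>2 * norm (vec_of_int k :: real ^ 'n) powr (2 * s))"
    by (simp add: sobolev_seminorm_character[OF assms(2)] power_mult_distrib powr_half_square)
       (simp add: power2_eq_square powr_add[symmetric])
  ultimately have "ennreal (?c * (C1\<^sup>2 * norm (vec_of_int k :: real ^ 'n) powr (2 * s))) \<le> ennreal (enn2real ?E)"
    by (intro ennreal_leI) simp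
  also have "\<dots> = ennreal ?c * character_energy s k"
    using fin by (simp add: difference_energy_character)
  finally show ?thesis
    by (subst (asm) ennreal_mult) (simp_all add: ennreal_mult_le_mult_iff)
qed

text \<open>
The converse membership that the equivalence of semi-norms does not contain. Up to constants, every finite part
of the Fourier sum is bounded by the energy, since each of its weights is bounded by the energy of the
corresponding character; for nonzero frequencies, whose norm is at least \<open>1\<close>, the weights of the
semi-norm and of the space are comparable.
\<close>

lemma finite_energy_imp_sobolev:
  fixes u :: "real ^ 'n::finite \<Rightarrow> complex"
  assumes eqv: "seminorm_equivalence_constants s C1 C2 TYPE('n)"
    and s: "0 < s" and u: "u \<in> torus_L2" and fin: "difference_energy s u < \<infinity>"
  shows "u \<in> sobolev_space s"
proof -
  let ?g = "\<lambda>k. norm (vec_of_int k :: real ^ 'n) powr (2 * s) * (cmod (fourier_coeff u k))\<^sup>2"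
  let ?h = "\<lambda>k. (1 + (norm (vec_of_int k :: real ^ 'n))\<^sup>2) powr s * (cmod (fourier_coeff u k))\<^sup>2"
  let ?c = "(2 * pi) ^ CARD('n) :: real"
  have C1: "0 < C1"
    using eqv by (simp add: seminorm_equivalence_constants_def)
  have bound: "sum ?g F \<le> enn2real (difference_energy s u) / (?c * C1\<^sup>2)" if "finite F" "F \<subseteq> UNIV - {0}" for F
  proof -
    have "ennreal (?c * C1\<^sup>2 * sum ?g F) = (\<Sum>k\<in>F. ennreal (?c * (cmod (fourier_coeff u k))\<^sup>2)
        * ennreal (C1\<^sup>2 * norm (vec_of_int k :: real ^ 'n) powr (2 * s)))"
      by (simp add: ennreal_mult[symmetric] sum_ennreal sum_distrib_left mult_ac)
    also have "\<dots> \<le> (\<Sum>k\<in>F. ennreal (?c * (cmod (fourier_coeff u k))\<^sup>2) * character_energy s k)"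
      using that by (intro sum_mono mult_left_mono character_energy_ge[OF eqv]) auto
    also have "\<dots> \<le> difference_energy s u"
      by (rule difference_energy_ge[OF u \<open>finite F\<close>])
    also have "\<dots> = ennreal (enn2real (difference_energy s u))"
      using fin by simp
    finally have "?c * C1\<^sup>2 * sum ?g F \<le> enn2real (difference_energy s u)"
      by (simp del: ennreal_enn2real ennreal_enn2real_if)
    then show ?thesis
      using C1 by (simp add: field_simps)
  qed
  have "?g summable_on UNIV - {0}"
    using bound by (intro nonneg_bdd_above_summable_on bdd_aboveI2) auto
  then have "(\<lambda>k. 2 powr s * ?g k) summable_on UNIV - {0}"
    by (rule summable_on_cmult_right)
  then have "?h summable_on UNIV - {0}"
  proof (rule summable_on_comparison_test)
    fix k :: "int ^ 'n" assume "k \<in> UNIV - {0}"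
    then have "1 \<le> norm (vec_of_int k :: real ^ 'n)"
      by (intro norm_vec_of_int_ge_1) simp
    then have "(1 + (norm (vec_of_int k :: real ^ 'n))\<^sup>2) powr s \<le> (2 * (norm (vec_of_int k :: real ^ 'n))\<^sup>2) powr s"
      using s by (intro powr_mono2) auto
    also have "\<dots> = 2 powr s * norm (vec_of_int k :: real ^ 'n) powr (2 * s)"
      by (simp add: powr_mult powr_add[symmetric] power2_eq_square)
    finally show "?h k \<le> 2 powr s * ?g k"
      by (simp add: mult.assoc[symmetric] mult_right_mono)
  qed simp
  then have "?h summable_on insert 0 (UNIV - {0})"
    by (simp only: summable_on_insert_iff)
  then have "?h summable_on UNIV"
    by (simp add: insert_absorb)
  then show ?thesis
    using u by (simp add: sobolev_space_def)
qed

section \<open>The nonlinear flow on Sobolev and square integrable functions\<close>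

text \<open>
Pass to the difference energy, contract it by the pointwise Lipschitz bound, and return. Before
returning, the image must be known to lie in the Sobolev space, as otherwise the lower bound of the
equivalence does not apply and the semi-norm could be the default value of a divergent sum.
\<close>

lemma Phi_B_sobolev:
  fixes w :: "real ^ 'n::finite \<Rightarrow> complex"
  assumes eqv: "seminorm_equivalence_constants s C1 C2 TYPE('n)"
    and s: "0 < s" and w: "w \<in> sobolev_space s"
  shows "Phi_B lam t w \<in> sobolev_space s"
    and "sobolev_seminorm s (Phi_B lam t w)
      \<le> inverse C1 * C2 * (1 + 2 * \<bar>lam\<bar> * \<bar>t\<bar>) * sobolev_seminorm s w"
proof -
  let ?K = "1 + 2 * \<bar>lam\<bar> * \<bar>t\<bar>"
  have C1: "0 < C1" and w_fin: "difference_energy s w < \<infinity>"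
    and upper: "sqrt (enn2real (difference_energy s w)) \<le> C2 * sobolev_seminorm s w"
    using eqv w by (auto simp: seminorm_equivalence_constants_def)
  have L2: "w \<in> torus_L2"
    using w by (simp add: sobolev_space_def)
  then have meas: "w \<in> borel_measurable lebesgue"
    by (simp add: torus_L2_iff)
  have le: "difference_energy s (Phi_B lam t w) \<le> ennreal (?K\<^sup>2) * difference_energy s w"
    by (rule difference_energy_contraction[OF meas Phi_B_measurable[OF meas] Phi_B_lipschitz])
  also have fin: "\<dots> < \<infinity>"
    using w_fin by (simp add: ennreal_mult_less_top)
  finally show mem: "Phi_B lam t w \<in> sobolev_space s"
    by (rule finite_energy_imp_sobolev[OF eqv s Phi_B_torus_L2[OF L2]])
  have "C1 * sobolev_seminorm s (Phi_B lam t w) \<le> sqrt (enn2real (difference_energy s (Phi_B lam t w)))"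
    using eqv mem by (simp add: seminorm_equivalence_constants_def)
  also have "\<dots> \<le> sqrt (enn2real (ennreal (?K\<^sup>2) * difference_energy s w))"
    using le fin by (intro real_sqrt_le_mono enn2real_mono) auto
  also have "\<dots> = ?K * sqrt (enn2real (difference_energy s w))"
    by (simp add: enn2real_mult real_sqrt_mult del: ennreal_power)
  also have "\<dots> \<le> ?K * (C2 * sobolev_seminorm s w)"
    by (intro mult_left_mono upper) simp
  finally show "sobolev_seminorm s (Phi_B lam t w) \<le> inverse C1 * C2 * ?K * sobolev_seminorm s w"
    using C1 by (simp add: field_simps)
qed

lemma Phi_B_L2_lipschitz:
  fixes u v :: "real ^ 'n::finite \<Rightarrow> complex"
  assumes "u \<in> torus_L2" "v \<in> torus_L2"
  shows "L2_norm_torus (\<lambda>x. Phi_B lam t u x - Phi_B lam t v x)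
    \<le> (1 + 2 * \<bar>lam\<bar> * \<bar>t\<bar>) * L2_norm_torus (\<lambda>x. u x - v x)"
proof -
  let ?K = "1 + 2 * \<bar>lam\<bar> * \<bar>t\<bar>"
  have int: "integrable torus_measure (\<lambda>x. (cmod (u x - v x))\<^sup>2)"
    "integrable torus_measure (\<lambda>x. (cmod (Phi_B lam t u x - Phi_B lam t v x))\<^sup>2)"
    using torus_L2_diff[OF assms] torus_L2_diff[OF assms[THEN Phi_B_torus_L2[of _ lam t]]]
    by (auto simp: torus_L2_iff)
  have "(cmod (Phi_B lam t u x - Phi_B lam t v x))\<^sup>2 \<le> ?K\<^sup>2 * (cmod (u x - v x))\<^sup>2" for x
    using power_mono[OF Phi_B_lipschitz[of lam t "\<lambda>z. z" "u x" "v x"], of 2]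
    by (simp add: power_mult_distrib Phi_B_compose[symmetric])
  then have "(\<integral>x. (cmod (Phi_B lam t u x - Phi_B lam t v x))\<^sup>2 \<partial>torus_measure)
      \<le> (\<integral>x. ?K\<^sup>2 * (cmod (u x - v x))\<^sup>2 \<partial>torus_measure)"
    using int by (intro integral_mono integrable_mult_right) auto
  then have "L2_norm_torus (\<lambda>x. Phi_B lam t u x - Phi_B lam t v x)
      \<le> sqrt (?K\<^sup>2 * (\<integral>x. (cmod (u x - v x))\<^sup>2 \<partial>torus_measure))"
    by (simp add: L2_norm_torus_def integral_torus_measure)
  then show ?thesis
    by (simp add: L2_norm_torus_def integral_torus_measure real_sqrt_mult)
qed

theorem theorem2p2:
  fixes lam t :: real
  assumes "lam \<noteq> 0" and "t > 0"
  shows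
    "(\<forall>w0 :: real ^ 'n::finite \<Rightarrow> complex. torus_periodic w0 \<longrightarrow>
        (\<forall>x\<in>torus. \<forall>y\<in>torus.
           cmod (Phi_B lam t w0 x - Phi_B lam t w0 y)
             \<le> (1 + 2 * \<bar>lam\<bar> * t) * cmod (w0 x - w0 y)) \<and>
        ((\<exists>L. L-lipschitz_on torus w0) \<longrightarrow> (\<exists>L. L-lipschitz_on torus (Phi_B lam t w0))) \<and>
        ((\<exists>L. L-lipschitz_on UNIV w0) \<longrightarrow> (\<exists>L. L-lipschitz_on UNIV (Phi_B lam t w0))))
     \<and>
     (\<forall>s C1 C2. 0 < s \<longrightarrow> s < 1 \<longrightarrow> seminorm_equivalence_constants s C1 C2 TYPE('n) \<longrightarrow>
        (\<forall>w0 \<in> (sobolev_space s :: (real ^ 'n \<Rightarrow> complex) set).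
           Phi_B lam t w0 \<in> sobolev_space s \<and>
           sobolev_seminorm s (Phi_B lam t w0)
             \<le> inverse C1 * C2 * (1 + 2 * \<bar>lam\<bar> * t) * sobolev_seminorm s w0))
     \<and>
     (\<forall>u \<in> torus_L2. \<forall>v \<in> (torus_L2 :: (real ^ 'n \<Rightarrow> complex) set).
        Phi_B lam t u \<in> torus_L2 \<and> Phi_B lam t v \<in> torus_L2 \<and>
        L2_norm_torus (\<lambda>x. Phi_B lam t u x - Phi_B lam t v x)
          \<le> (1 + 2 * \<bar>lam\<bar> * t) * L2_norm_torus (\<lambda>x. u x - v x))"
proof (intro conjI allI impI ballI)
  note abs_t = abs_of_pos[OF assms(2)]
  fix w0 :: "real ^ 'n \<Rightarrow> complex" and x y
  show "cmod (Phi_B lam t w0 x - Phi_B lam t w0 y) \<le> (1 + 2 * \<bar>lam\<bar> * t) * cmod (w0 x - w0 y)"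
    using Phi_B_lipschitz[of lam t w0 x y] by (simp add: abs_t)
  show "\<exists>L. L-lipschitz_on torus (Phi_B lam t w0)" if "\<exists>L. L-lipschitz_on torus w0"
    using that Phi_B_lipschitz_on by blast
  show "\<exists>L. L-lipschitz_on UNIV (Phi_B lam t w0)" if "\<exists>L. L-lipschitz_on UNIV w0"
    using that Phi_B_lipschitz_on by blast
next
  fix s C1 C2 and w0 :: "real ^ 'n \<Rightarrow> complex"
  assume *: "0 < s" "seminorm_equivalence_constants s C1 C2 TYPE('n)" "w0 \<in> sobolev_space s"
  show "Phi_B lam t w0 \<in> sobolev_space s"
    by (rule Phi_B_sobolev(1)[OF *(2,1,3)])
  show "sobolev_seminorm s (Phi_B lam t w0)
      \<le> inverse C1 * C2 * (1 + 2 * \<bar>lam\<bar> * t) * sobolev_seminorm s w0"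
    using Phi_B_sobolev(2)[OF *(2,1,3), of lam t] assms(2) by simp
next
  fix u v :: "real ^ 'n \<Rightarrow> complex"
  assume *: "u \<in> torus_L2" "v \<in> torus_L2"
  show "Phi_B lam t u \<in> torus_L2" "Phi_B lam t v \<in> torus_L2"
    using * by (simp_all add: Phi_B_torus_L2)
  show "L2_norm_torus (\<lambda>x. Phi_B lam t u x - Phi_B lam t v x)
      \<le> (1 + 2 * \<bar>lam\<bar> * t) * L2_norm_torus (\<lambda>x. u x - v x)"
    using Phi_B_L2_lipschitz[OF *, of lam t] assms(2) by simp
qed

end
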